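(* Let $A$ be an $n\times n$ 0-1 matrix with $\operatorname{per}A>0$, let $m$ be as defined in the context, and assume $m\ge1$. Let $\epsilon>0$ and run Algorithm 5.2 on $A$ with precision $\epsilon$. Then there is a number $\rho\in[0,1/2]$ (depending on $A$ and the chosen maps $\phi_i$, not on the random strings) satisfying $$1-H\Bigl(\frac12-\rho\Bigr)\le\frac{\log_2\operatorname{per}A}{m}\le H(\rho)$$ such that, with probability at least $0.9$, the output $\beta$ satisfies $|\beta-\rho|\le\epsilon$. To compute $\beta$ the algorithm solves $k=\lceil48/(m\epsilon^2)\rceil$ assignment problems of size $n\times n$.
   Context: For an $n\times n$ matrix $A=(a_{ij})$, $\operatorname{per}A=\sum_{\sigma\in S_n}\prod_{i=1}^na_{i\sigma(i)}$. Let $s_i^+=\sum_ja_{ij}$ (row sums), $s_j^-=\sum_ia_{ij}$ (column sums), $m^+=\sum_i\lceil\log_2s_i^+\rceil$, $m^-=\sum_j\lceil\log_2s_j^-\rceil$, $m=\min(m^+,m^-)$. The entropy function is $H(x)=x\log_2\frac1x+(1-x)\log_2\frac1{1-x}$ on $[0,1/2]$, $H(0)=0$; $\operatorname{dist}$ is Hamming distance between binary strings of equal length. Algorithm 5.2 (input: $A$, $\epsilon>0$): If $m^->m^+$ is false and $m^-<m^+$, replace $A$ by its transpose (this does not change the permanent); thus afterwards $m=\sum_i m_i$ with $m_i=\lceil\log_2 s_i\rceil$, $s_i$ the $i$-th row sum of the current matrix. For each row $i$ choose an injective map $\phi_i$ from $\{j:a_{ij}=1\}$ to $\{0,1\}^{m_i}$.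 Let $k=\lceil48/(m\epsilon^2)\rceil$ and draw independent uniformly random strings $x_1,\dots,x_k\in\{0,1\}^m$. For each such $x$, write $x=y_1y_2\cdots y_n$ with $y_i\in\{0,1\}^{m_i}$, give the entry $(i,j)$ with $a_{ij}=1$ the weight $\gamma_{ij}=\operatorname{dist}(\phi_i(j),y_i)$, and let $\alpha(x)=\min\{\sum_i\gamma_{i\sigma(i)}:\sigma\in S_n,\ a_{i\sigma(i)}=1\ \forall i\}$ (an assignment problem). Let $\alpha=\frac1k\sum_{t=1}^k\alpha(x_t)$ and output $\beta=\frac12-\frac{\alpha}{m}$. *)

theory Defs
  imports "HOL-Probability.Probability" "Jordan_Normal_Form.Matrix"
begin

definition permanent :: "'a::comm_semiring_1 mat \<Rightarrow> 'a" where
  "permanent A = (\<Sum>\<sigma> | \<sigma> permutes {0..<dim_row A}. \<Prod>i = 0..<dim_row A. A $$ (i, \<sigma> i))"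

definition row_sum :: "real mat \<Rightarrow> nat \<Rightarrow> real" where
  "row_sum A i = (\<Sum>j = 0..<dim_col A. A $$ (i, j))"

definition col_sum :: "real mat \<Rightarrow> nat \<Rightarrow> real" where
  "col_sum A j = (\<Sum>i = 0..<dim_row A. A $$ (i, j))"

text \<open>
  The theorem is about 0-1 matrices with positive permanent. Their row and column sums are at
  least 1, so the logarithms below are taken of positive numbers and the conversions to
  \<open>nat\<close> lose nothing.
\<close>

definition row_bits :: "real mat \<Rightarrow> nat \<Rightarrow> nat" where
  "row_bits A i = nat \<lceil>log 2 (row_sum A i)\<rceil>"

definition col_bits :: "real mat \<Rightarrow> nat \<Rightarrow> nat" where
  "col_bits A j = nat \<lceil>log 2 (col_sum A j)\<rceil>"

definition m_plus :: "real mat \<Rightarrow> nat" where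
  "m_plus A = (\<Sum>i = 0..<dim_row A. row_bits A i)"

definition m_minus :: "real mat \<Rightarrow> nat" where
  "m_minus A = (\<Sum>j = 0..<dim_col A. col_bits A j)"

definition m_min :: "real mat \<Rightarrow> nat" where
  "m_min A = min (m_plus A) (m_minus A)"

text \<open>Binary entropy in bits; it is used on the interval from 0 to 1/2 only.\<close>

definition bin_entropy :: "real \<Rightarrow> real" where
  "bin_entropy x = (if x = 0 then 0 else x * log 2 (1 / x) + (1 - x) * log 2 (1 / (1 - x)))"

text \<open>Hamming distance; it is applied to strings of equal length only.\<close>

definition hamming_dist :: "bool list \<Rightarrow> bool list \<Rightarrow> nat" where
  "hamming_dist u v = card {i. i < length u \<and> u ! i \<noteq> v ! i}"

text \<open>
  An instance of the assignment problem is a square matrix of weights in which \<open>None\<close> marks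
  the forbidden positions.
\<close>

type_synonym assignment_problem = "nat option mat"

definition assignments :: "assignment_problem \<Rightarrow> (nat \<Rightarrow> nat) set" where
  "assignments W =
     {\<sigma>. \<sigma> permutes {0..<dim_row W} \<and> (\<forall>i<dim_row W. W $$ (i, \<sigma> i) \<noteq> None)}"

definition min_assignment :: "assignment_problem \<Rightarrow> nat" where
  "min_assignment W =
     Min ((\<lambda>\<sigma>. \<Sum>i = 0..<dim_row W. the (W $$ (i, \<sigma> i))) ` assignments W)"

text \<open>
  The solver is the only access of the algorithm to assignment problems. Together with the
  optimal value it returns a log of the instance solved, so that a run of the algorithm comes
  with the list of all assignment problems solved in it.
\<close>

definition solve :: "assignment_problem \<Rightarrow> nat \<times> assignment_problem list" where
  "solve W = (min_assignment W, [W])"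

definition oriented :: "real mat \<Rightarrow> real mat" where
  "oriented A = (if m_minus A < m_plus A then transpose_mat A else A)"

text \<open>The maps \<open>\<phi> i\<close> matter only on the positions of the ones in row \<open>i\<close>.\<close>

definition row_codes :: "real mat \<Rightarrow> (nat \<Rightarrow> nat \<Rightarrow> bool list) \<Rightarrow> bool" where
  "row_codes B \<phi> \<longleftrightarrow> (\<forall>i<dim_row B.
     inj_on (\<phi> i) {j. j < dim_col B \<and> B $$ (i, j) = 1} \<and>
     \<phi> i ` {j. j < dim_col B \<and> B $$ (i, j) = 1} \<subseteq> {y. length y = row_bits B i})"

definition block :: "real mat \<Rightarrow> bool list \<Rightarrow> nat \<Rightarrow> bool list" where
  "block B x i = take (row_bits B i) (drop (\<Sum>l = 0..<i. row_bits B l) x)"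

definition weighting ::
    "real mat \<Rightarrow> (nat \<Rightarrow> nat \<Rightarrow> bool list) \<Rightarrow> bool list \<Rightarrow> assignment_problem" where
  "weighting B \<phi> x = mat (dim_row B) (dim_col B) (\<lambda>(i, j).
     if B $$ (i, j) = 1 then Some (hamming_dist (\<phi> i j) (block B x i)) else None)"

text \<open>The part of the algorithm after the strings have been drawn.\<close>

definition estimate ::
    "real mat \<Rightarrow> (nat \<Rightarrow> nat \<Rightarrow> bool list) \<Rightarrow> bool list list \<Rightarrow> real \<times> assignment_problem list" where
  "estimate A \<phi> xs =
     (let results = map (\<lambda>x. solve (weighting (oriented A) \<phi> x)) xs;
          \<alpha> = (\<Sum>r\<leftarrow>results. real (fst r)) / real (length xs)
      in (1 / 2 - \<alpha> / real (m_min A), concat (map snd results)))"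

definition num_samples :: "real mat \<Rightarrow> real \<Rightarrow> nat" where
  "num_samples A \<epsilon> = nat \<lceil>48 / (real (m_min A) * \<epsilon>\<^sup>2)\<rceil>"

text \<open>
  The joint distribution of the output and of the list of assignment problems solved, for
  independent uniformly random strings.
\<close>

definition algorithm ::
    "real mat \<Rightarrow> (nat \<Rightarrow> nat \<Rightarrow> bool list) \<Rightarrow> real \<Rightarrow> (real \<times> assignment_problem list) pmf" where
  "algorithm A \<phi> \<epsilon> =
     map_pmf (estimate A \<phi>)
       (replicate_pmf (num_samples A \<epsilon>) (pmf_of_set {x :: bool list. length x = m_min A}))"

lemma m_plus_oriented: "m_plus (oriented A) = m_min A"
proof -
  have "row_bits (transpose_mat A) j = col_bits A j" if "j < dim_col A" for j
    using that by (simp add: row_bits_def col_bits_def row_sum_def col_sum_def)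
  then show ?thesis
    by (simp add: oriented_def m_min_def m_plus_def m_minus_def)
qed

lemma row_codes_exist:
  assumes "elements_mat B \<subseteq> {0, 1}"
  shows "\<exists>\<phi>. row_codes B \<phi>"
proof -
  have "\<exists>f. inj_on f {j. j < dim_col B \<and> B $$ (i, j) = 1} \<and>
      f ` {j. j < dim_col B \<and> B $$ (i, j) = 1} \<subseteq> {y :: bool list. length y = row_bits B i}"
    if i: "i < dim_row B" for i
  proof -
    let ?J = "{j. j < dim_col B \<and> B $$ (i, j) = 1}"
    let ?C = "{y :: bool list. length y = row_bits B i}"
    have entry: "B $$ (i, j) = (if B $$ (i, j) = 1 then 1 else 0)" if "j < dim_col B" for j
      using assms elements_matI[of B "dim_row B" "dim_col B" i j] i that by auto
    have "row_sum B i = (\<Sum>j = 0..<dim_col B. if B $$ (i, j) = 1 then 1 else 0)"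
      unfolding row_sum_def by (rule sum.cong) (use entry in auto)
    also have "\<dots> = real (card ({0..<dim_col B} \<inter> {j. B $$ (i, j) = 1}))"
      by (simp add: sum.If_cases)
    also have "{0..<dim_col B} \<inter> {j. B $$ (i, j) = 1} = ?J" by auto
    finally have sum: "row_sum B i = real (card ?J)" .
    have "card ?J \<le> 2 ^ row_bits B i"
    proof (cases "card ?J = 0")
      case False
      then have pos: "0 < real (card ?J)" by linarith
      have "log 2 (real (card ?J)) \<le> real (row_bits B i)"
        unfolding row_bits_def sum by linarith
      then have "real (card ?J) \<le> 2 powr real (row_bits B i)"
        using log_le_iff[OF _ pos, of 2 "real (row_bits B i)"] by linarith
      then have "real (card ?J) \<le> real (2 ^ row_bits B i)"
        by (simp add: powr_realpow)
      then show ?thesis by (simp only: of_nat_le_iff)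
    next
      case True
      then show ?thesis by (simp only: zero_le)
    qed
    moreover have "card ?C = 2 ^ row_bits B i"
      using card_lists_length_eq[of "UNIV :: bool set" "row_bits B i"] by simp
    moreover have "finite ?C"
      using finite_lists_length_eq[of "UNIV :: bool set" "row_bits B i"] by simp
    ultimately show ?thesis
      using card_le_inj[of ?J ?C] by auto
  qed
  then have "\<forall>i. \<exists>f. i < dim_row B \<longrightarrow> inj_on f {j. j < dim_col B \<and> B $$ (i, j) = 1} \<and>
      f ` {j. j < dim_col B \<and> B $$ (i, j) = 1} \<subseteq> {y :: bool list. length y = row_bits B i}"
    by blast
  from choice[OF this] show ?thesis
    unfolding row_codes_def by blast
qed

end

theory Submission
  imports Defs
begin

text \<open>
  Concatenating the codes \<open>\<phi> i (\<sigma> i)\<close> identifies the permutations counted by the permanent with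
  a set \<open>X\<close> of vertices of the cube of dimension \<open>m\<close>, and the assignment problem for \<open>x\<close> computes the
  Hamming distance \<open>d x\<close> from \<open>x\<close> to \<open>X\<close>. Let \<open>D\<close> be the mean of \<open>d\<close> over the cube and
  \<open>\<rho> = 1/2 - D/m\<close>. For the lower bound, the sum of \<open>p ^ d x * (1 - p) ^ (m - d x)\<close> over the cube is
  at most \<open>card X\<close>, and Jensen's inequality is applied with \<open>p = D/m\<close>. For the upper bound,
  \<open>card X \<le> (1 + 1/t) ^ m * t powr (m/2 - D)\<close> for all \<open>t \<ge> 1\<close> by induction on \<open>m\<close>, and
  \<open>t = (1 - \<rho>)/\<rho>\<close> is optimal. Since \<open>d\<close> is 1-Lipschitz, its variance is at most \<open>m/4\<close>, and
  Chebyshev's inequality bounds the failure probability by \<open>1/192\<close>.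
\<close>

section \<open>Averages over the Boolean cube\<close>

definition cube_avg :: "nat \<Rightarrow> (bool list \<Rightarrow> real) \<Rightarrow> real" where
  "cube_avg m f = (\<Sum>x | length x = m. f x) / 2 ^ m"

lemma finite_cube: "finite {x :: bool list. length x = m}"
  using finite_lists_length_eq[of "UNIV :: bool set" m] by simp

lemma card_cube: "card {x :: bool list. length x = m} = 2 ^ m"
  using card_lists_length_eq[of "UNIV :: bool set" m] by simp

lemma cube_nonempty: "{x :: bool list. length x = m} \<noteq> {}"
  using length_replicate[of m True] by (auto intro: exI[of _ "replicate m True"])

lemma cube_avg_0 [simp]: "cube_avg 0 f = f []"
  by (simp add: cube_avg_def)

text \<open>Conditioning on the first bit is the step behind the inductions on the dimension
  below.\<close>

lemma cube_avg_Suc: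
  "cube_avg (Suc m) f = (cube_avg m (\<lambda>x. f (True # x)) + cube_avg m (\<lambda>x. f (False # x))) / 2"
proof -
  have "{x :: bool list. length x = Suc m} =
      (#) True ` {x. length x = m} \<union> (#) False ` {x. length x = m}"
    by (auto simp: length_Suc_conv)
  then have "(\<Sum>x | length x = Suc m. f x) =
      sum f ((#) True ` {x. length x = m}) + sum f ((#) False ` {x. length x = m})"
    by (simp only:) (rule sum.union_disjoint; auto simp: finite_cube)
  then show ?thesis
    by (simp add: cube_avg_def sum.reindex inj_on_def add_divide_distrib)
qed

lemma cube_avg_const [simp]: "cube_avg m (\<lambda>x. c) = c"
  by (simp add: cube_avg_def card_cube)

lemma cube_avg_add: "cube_avg m (\<lambda>x. f x + g x) = cube_avg m f + cube_avg m g"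
  by (simp add: cube_avg_def sum.distrib add_divide_distrib)

lemma cube_avg_diff: "cube_avg m (\<lambda>x. f x - g x) = cube_avg m f - cube_avg m g"
  by (simp add: cube_avg_def sum_subtractf diff_divide_distrib)

lemma cube_avg_cmult: "cube_avg m (\<lambda>x. c * f x) = c * cube_avg m f"
  by (simp add: cube_avg_def sum_distrib_left)

lemma cube_avg_cong:
  "(\<And>x. length x = m \<Longrightarrow> f x = g x) \<Longrightarrow> cube_avg m f = cube_avg m g"
  by (simp add: cube_avg_def)

lemma cube_avg_mono:
  "(\<And>x. length x = m \<Longrightarrow> f x \<le> g x) \<Longrightarrow> cube_avg m f \<le> cube_avg m g"
  by (auto simp: cube_avg_def intro!: divide_right_mono sum_mono)

lemma expectation_cube:
  "measure_pmf.expectation (pmf_of_set {x :: bool list. length x = m}) f = cube_avg m f"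
  unfolding cube_avg_def integral_pmf_of_set[OF cube_nonempty finite_cube] card_cube by simp

text \<open>Jensen's inequality for \<open>exp\<close>: the graph lies above its tangent at the mean
  \<open>c\<close>, and averaging the tangent gives \<open>exp c\<close>.\<close>

lemma exp_cube_avg_le: "exp (cube_avg m f) \<le> cube_avg m (\<lambda>x. exp (f x))"
proof -
  define c where "c = cube_avg m f"
  have "exp c * (1 + (f x - c)) \<le> exp (f x)" for x
    using mult_left_mono[OF exp_ge_add_one_self[of "f x - c"], of "exp c"]
    by (simp flip: exp_add)
  then have "cube_avg m (\<lambda>x. exp c * (1 + (f x - c))) \<le> cube_avg m (\<lambda>x. exp (f x))"
    by (intro cube_avg_mono)
  then show ?thesis
    by (simp add: cube_avg_cmult cube_avg_add cube_avg_diff c_def)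
qed

section \<open>Hamming distance and its averages\<close>

lemma hamming_dist_Nil [simp]: "hamming_dist [] v = 0"
  by (simp add: hamming_dist_def)

lemma hamming_dist_self [simp]: "hamming_dist u u = 0"
  by (simp add: hamming_dist_def)

lemma hamming_dist_Cons [simp]:
  "hamming_dist (a # u) (b # v) = of_bool (a \<noteq> b) + hamming_dist u v"
proof -
  let ?D = "{i. i < length u \<and> u ! i \<noteq> v ! i}"
  have "{i. i < length (a # u) \<and> (a # u) ! i \<noteq> (b # v) ! i} =
      (if a \<noteq> b then insert 0 (Suc ` ?D) else Suc ` ?D)"
    by (auto simp: less_Suc_eq_0_disj)
  then show ?thesis
    by (auto simp: hamming_dist_def card_image card_insert_if)
qed

lemma hamming_dist_append:
  "length u = length v \<Longrightarrow>
    hamming_dist (u @ u') (v @ v') = hamming_dist u v + hamming_dist u' v'"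
  by (induction u v rule: list_induct2) auto

lemma hamming_dist_concat:
  assumes "\<And>i. i \<in> set is \<Longrightarrow> length (u i) = length (v i)"
  shows "hamming_dist (concat (map u is)) (concat (map v is)) =
    (\<Sum>i\<leftarrow>is. hamming_dist (u i) (v i))"
  using assms by (induction "is") (auto simp: hamming_dist_append)

lemma hamming_dist_le_length: "hamming_dist u v \<le> length u"
  unfolding hamming_dist_def
  using card_mono[of "{..<length u}" "{i. i < length u \<and> u ! i \<noteq> v ! i}"] by auto

lemma hamming_dist_commute: "length u = length v \<Longrightarrow> hamming_dist u v = hamming_dist v u"
  by (auto simp: hamming_dist_def intro!: arg_cong[where f = card])

lemma hamming_dist_triangle:
  assumes "length u = length v"
  shows "hamming_dist u w \<le> hamming_dist u v + hamming_dist v w"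
proof -
  have "{i. i < length u \<and> u ! i \<noteq> w ! i} \<subseteq>
      {i. i < length u \<and> u ! i \<noteq> v ! i} \<union> {i. i < length v \<and> v ! i \<noteq> w ! i}"
    using assms by auto
  then have "hamming_dist u w \<le>
      card ({i. i < length u \<and> u ! i \<noteq> v ! i} \<union> {i. i < length v \<and> v ! i \<noteq> w ! i})"
    unfolding hamming_dist_def by (intro card_mono) auto
  also have "\<dots> \<le> hamming_dist u v + hamming_dist v w"
    unfolding hamming_dist_def by (rule card_Un_le)
  finally show ?thesis .
qed

text \<open>By symmetry each coordinate of \<open>x\<close> disagrees with \<open>y\<close> on
  exactly half of the cube.\<close>

lemma cube_avg_hamming_dist: "cube_avg (length y) (\<lambda>x. real (hamming_dist y x)) = length y / 2"
  by (induction y) (auto simp: cube_avg_Suc cube_avg_add field_simps)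

text \<open>For \<open>p\<close> in the unit interval the weight is the probability of reaching
  \<open>x\<close> when each bit of \<open>y\<close> is flipped independently with probability
  \<open>p\<close>. The total over the cube is \<open>(p + (1 - p)) ^ length y = 1\<close> for every
  real \<open>p\<close>.\<close>

lemma cube_avg_binomial_weights:
  fixes p :: real
  shows "cube_avg (length y) (\<lambda>x. p ^ hamming_dist y x * (1 - p) ^ (length y - hamming_dist y x)) =
    1 / 2 ^ length y"
proof (induction y)
  case (Cons b y)
  let ?w = "\<lambda>x. p ^ hamming_dist y x * (1 - p) ^ (length y - hamming_dist y x)"
  have "cube_avg (length y) (\<lambda>x. p ^ hamming_dist (b # y) (c # x) *
        (1 - p) ^ (length (b # y) - hamming_dist (b # y) (c # x)))
      = (if b = c then 1 - p else p) * (1 / 2 ^ length y)" for c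
  proof -
    \<comment> \<open>The subtraction in the exponent is on naturals, so the bound of the distance
      by \<open>length y\<close> is what lets \<open>Suc\<close> be pulled out.\<close>
    have "p ^ hamming_dist (b # y) (c # x) * (1 - p) ^ (length (b # y) - hamming_dist (b # y) (c # x))
        = (if b = c then 1 - p else p) * ?w x" for x
      using hamming_dist_le_length[of y x] by (simp add: Suc_diff_le)
    then show ?thesis
      unfolding Cons.IH[symmetric] cube_avg_cmult[symmetric] by (simp only:)
  qed
  from this[of True] this[of False] show ?case
    by (cases b) (simp_all add: cube_avg_Suc flip: add_divide_distrib del: hamming_dist_Cons)
qed simp

text \<open>Conditioning on the first bit, the variance is the mean of the variances on the two
  halves plus a quarter of the squared difference of their means. The Lipschitz condition bounds
  that difference by 1, so each dimension adds at most 1/4.\<close>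

lemma cube_avg_variance_le:
  assumes "\<And>x y. length x = m \<Longrightarrow> length y = m \<Longrightarrow> \<bar>f x - f y\<bar> \<le> real (hamming_dist x y)"
  shows "cube_avg m (\<lambda>x. (f x)\<^sup>2) - (cube_avg m f)\<^sup>2 \<le> real m / 4"
  using assms
proof (induction m arbitrary: f)
  case (Suc m)
  let ?g = "\<lambda>b x. f (b # x)"
  have IH: "cube_avg m (\<lambda>x. (?g b x)\<^sup>2) - (cube_avg m (?g b))\<^sup>2 \<le> real m / 4" for b
  proof (rule Suc.IH)
    fix x y :: "bool list" assume "length x = m" "length y = m"
    then show "\<bar>f (b # x) - f (b # y)\<bar> \<le> real (hamming_dist x y)"
      using Suc.prems[of "b # x" "b # y"] by simp
  qed
  have step: "cube_avg m (?g b) \<le> cube_avg m (?g c) + 1" for b c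
  proof -
    have "?g b x \<le> ?g c x + 1" if "length x = m" for x
      using Suc.prems[of "b # x" "c # x"] that by (cases "b = c") auto
    then have "cube_avg m (?g b) \<le> cube_avg m (\<lambda>x. ?g c x + 1)"
      by (rule cube_avg_mono)
    then show ?thesis by (simp add: cube_avg_add)
  qed
  have "\<bar>cube_avg m (?g True) - cube_avg m (?g False)\<bar> \<le> 1"
    using step[of True False] step[of False True] by linarith
  then have "(cube_avg m (?g True) - cube_avg m (?g False))\<^sup>2 \<le> 1"
    by (simp add: abs_square_le_1)
  then show ?case
    using IH[of True] IH[of False]
    by (simp add: cube_avg_Suc power2_eq_square field_simps)
qed simp

section \<open>Distance to a set of vertices and the lower entropy bound\<close>

definition set_dist :: "bool list set \<Rightarrow> bool list \<Rightarrow> nat" where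
  "set_dist X x = Min ((\<lambda>y. hamming_dist y x) ` X)"

lemma finite_subset_cube: "X \<subseteq> {x :: bool list. length x = m} \<Longrightarrow> finite X"
  using finite_cube finite_subset by blast

lemma set_dist_le: "finite X \<Longrightarrow> y \<in> X \<Longrightarrow> set_dist X x \<le> hamming_dist y x"
  by (simp add: set_dist_def)

lemma set_dist_attained:
  assumes "finite X" "X \<noteq> {}"
  obtains y where "y \<in> X" "set_dist X x = hamming_dist y x"
  using Min_in[of "(\<lambda>y. hamming_dist y x) ` X"] assms unfolding set_dist_def by blast

lemma set_dist_le_dim:
  assumes "X \<subseteq> {x. length x = m}" "X \<noteq> {}"
  shows "set_dist X x \<le> m"
proof -
  obtain y where "y \<in> X" "set_dist X x = hamming_dist y x"
    using set_dist_attained[OF finite_subset_cube[OF assms(1)] assms(2)] .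
  then show ?thesis
    using assms(1) hamming_dist_le_length[of y x] by auto
qed

lemma set_dist_Lipschitz:
  assumes X: "X \<subseteq> {x. length x = m}" "X \<noteq> {}" and len: "length x = m" "length x' = m"
  shows "\<bar>real (set_dist X x) - real (set_dist X x')\<bar> \<le> real (hamming_dist x x')"
proof -
  have le: "set_dist X x \<le> set_dist X x' + hamming_dist x' x"
    if len: "length x = m" "length x' = m" for x x'
  proof -
    obtain y where y: "y \<in> X" "set_dist X x' = hamming_dist y x'"
      using set_dist_attained[OF finite_subset_cube[OF X(1)] X(2)] .
    have "set_dist X x \<le> hamming_dist y x"
      using set_dist_le[OF finite_subset_cube[OF X(1)] y(1)] .
    also have "\<dots> \<le> hamming_dist y x' + hamming_dist x' x"
      using y X len by (intro hamming_dist_triangle) auto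
    finally show ?thesis using y by simp
  qed
  show ?thesis
    using le[OF len] le[of x' x] len hamming_dist_commute[of x x'] by linarith
qed

text \<open>A single point of \<open>X\<close> already has mean distance \<open>m / 2\<close>. This
  bound makes \<rho> nonnegative.\<close>

lemma avg_set_dist_le_half:
  assumes "X \<subseteq> {x. length x = m}" "X \<noteq> {}"
  shows "cube_avg m (set_dist X) \<le> real m / 2"
proof -
  obtain y where y: "y \<in> X" using assms by blast
  then have len: "length y = m" using assms by auto
  have "cube_avg m (set_dist X) \<le> cube_avg m (\<lambda>x. real (hamming_dist y x))"
    using set_dist_le[OF finite_subset_cube[OF assms(1)] y] by (intro cube_avg_mono) simp
  then show ?thesis using cube_avg_hamming_dist[of y] len by simp
qed

text \<open>The nearest point of \<open>X\<close> contributes one term of the double sum over \<open>x\<close> and \<open>X\<close>.\<close>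

lemma card_ge_binomial_weights:
  fixes p :: real
  assumes X: "X \<subseteq> {x. length x = m}" "X \<noteq> {}" and p: "0 \<le> p" "p \<le> 1"
  shows "2 ^ m * cube_avg m (\<lambda>x. p ^ set_dist X x * (1 - p) ^ (m - set_dist X x)) \<le> card X"
proof -
  let ?w = "\<lambda>y x. p ^ hamming_dist y x * (1 - p) ^ (m - hamming_dist y x)"
  have "p ^ set_dist X x * (1 - p) ^ (m - set_dist X x) \<le> (\<Sum>y\<in>X. ?w y x)" for x
  proof -
    obtain y where y: "y \<in> X" "set_dist X x = hamming_dist y x"
      using set_dist_attained[OF finite_subset_cube[OF X(1)] X(2)] .
    have "?w y x \<le> (\<Sum>y\<in>X. ?w y x)"
      using y(1) finite_subset_cube[OF X(1)] p by (intro member_le_sum) auto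
    then show ?thesis using y by simp
  qed
  then have "cube_avg m (\<lambda>x. p ^ set_dist X x * (1 - p) ^ (m - set_dist X x))
      \<le> cube_avg m (\<lambda>x. \<Sum>y\<in>X. ?w y x)"
    by (intro cube_avg_mono)
  also have "\<dots> = (\<Sum>y\<in>X. cube_avg m (?w y))"
    unfolding cube_avg_def by (subst sum.swap) (simp add: sum_divide_distrib)
  also have "\<dots> = (\<Sum>y\<in>X. 1 / 2 ^ m)"
  proof (rule sum.cong)
    fix y assume "y \<in> X"
    then have "length y = m" using X(1) by blast
    then show "cube_avg m (?w y) = 1 / 2 ^ m"
      using cube_avg_binomial_weights[of y p] by simp
  qed simp
  finally show ?thesis by (simp add: field_simps)
qed

text \<open>The logarithm of a weight in \<open>card_ge_binomial_weights\<close> is affine in the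
  distance, so after Jensen's inequality only the mean distance \<open>D\<close> survives. With
  \<open>p = D / m\<close> the exponent becomes an entropy.\<close>

lemma card_ge_entropy:
  assumes X: "X \<subseteq> {x. length x = m}" "X \<noteq> {}" and m: "m \<ge> 1"
  shows "1 - bin_entropy (cube_avg m (set_dist X) / m) \<le> log 2 (card X) / m"
proof -
  define D where "D = cube_avg m (set_dist X)"
  define p where "p = D / m"
  have "0 \<le> D" unfolding D_def using cube_avg_mono[of m "\<lambda>x. 0" "set_dist X"] by simp
  then have p: "0 \<le> p" "p \<le> 1 / 2"
    using avg_set_dist_le_half[OF X] m by (auto simp: p_def D_def field_simps)
  have card: "card X > 0" using X finite_subset_cube by (auto simp: card_gt_0_iff)
  show ?thesis
  proof (cases "p = 0")
    case True
    \<comment> \<open>Zero mean forces the distance to vanish on the whole cube. At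
      \<open>p = 0\<close> every weight is then \<open>0 ^ 0 * 1 ^ m = 1\<close>.\<close>
    then have "(\<Sum>x | length x = m. real (set_dist X x)) = 0"
      using m by (simp add: p_def D_def cube_avg_def)
    then have "set_dist X x = 0" if "length x = m" for x
      using that finite_cube[of m] by (subst (asm) sum_nonneg_eq_0_iff) auto
    then have "2 ^ m \<le> real (card X)"
      using card_ge_binomial_weights[OF X, of 0] cube_avg_cong[of m _ "\<lambda>x. 1"] by simp
    then have "real m \<le> log 2 (card X)"
      by (simp add: le_log_iff card powr_realpow)
    then show ?thesis using m True by (simp add: bin_entropy_def p_def D_def)
  next
    case False
    then have p0: "0 < p" "p < 1" using p by auto
    define f where "f x = real (set_dist X x) * ln p + (real m - set_dist X x) * ln (1 - p)" for x
    have "exp (f x) = p ^ set_dist X x * (1 - p) ^ (m - set_dist X x)" for x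
      using p0 set_dist_le_dim[OF X, of x]
      by (simp add: f_def exp_add exp_of_nat_mult flip: of_nat_diff)
    then have "2 ^ m * cube_avg m (\<lambda>x. exp (f x)) \<le> card X"
      using card_ge_binomial_weights[OF X, of p] p by simp
    then have "2 ^ m * exp (cube_avg m f) \<le> card X"
      by (rule order_trans[rotated]) (intro mult_left_mono exp_cube_avg_le; simp)
    moreover have "cube_avg m f =
        cube_avg m (\<lambda>x. ln p * set_dist X x + ln (1 - p) * (real m - set_dist X x))"
      by (rule cube_avg_cong) (simp add: f_def mult.commute)
    then have "cube_avg m f = D * ln p + (m - D) * ln (1 - p)"
      by (simp add: cube_avg_add cube_avg_cmult cube_avg_diff D_def mult.commute)
    ultimately have "exp (D * ln p + (m - D) * ln (1 - p) + m * ln 2) \<le> card X"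
      by (simp add: exp_add exp_of_nat_mult mult.commute)
    then have "D * ln p + (m - D) * ln (1 - p) + m * ln 2 \<le> ln (card X)"
      using card by (simp add: ln_ge_iff)
    moreover have "D = p * m" using m by (simp add: p_def)
    ultimately have "m * (p * ln p + (1 - p) * ln (1 - p) + ln 2) \<le> ln (card X)"
      by (simp add: algebra_simps)
    then have "p * ln p + (1 - p) * ln (1 - p) + ln 2 \<le> ln (card X) / m"
      using m by (simp add: pos_le_divide_eq mult.commute)
    then have "(p * ln p + (1 - p) * ln (1 - p) + ln 2) / ln 2 \<le> ln (card X) / m / ln 2"
      by (rule divide_right_mono) simp
    moreover have "1 - bin_entropy p = (p * ln p + (1 - p) * ln (1 - p) + ln 2) / ln 2"
      using False p0 by (simp add: bin_entropy_def log_def ln_div field_simps)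
    ultimately show ?thesis by (simp add: p_def D_def log_def mult.commute)
  qed
qed

section \<open>The upper entropy bound by induction on the dimension\<close>

lemma powr_add_powr_le:
  fixes t :: real
  assumes t: "1 \<le> t" and E: "a \<le> E" "b \<le> E" "(a + b + 1) / 2 \<le> E"
  shows "t powr a + t powr b \<le> (1 + 1 / t) * t powr E"
proof -
  have main: "t powr a + t powr b \<le> (1 + 1 / t) * t powr E"
    if E: "a \<le> E" "(a + b + 1) / 2 \<le> E" and le: "b \<le> a" for a b
  proof (cases "a - b \<ge> 1")
    case True
    \<comment> \<open>With a gap of at least 1, \<open>b \<le> a - 1 \<le> E - 1\<close>, so the
      smaller power accounts for the term with factor \<open>1 / t\<close>.\<close>
    have "t powr b \<le> t powr (E - 1)" using True E t by (intro powr_mono) auto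
    also have "\<dots> = t powr E / t" using t by (simp add: powr_diff)
    finally have "t powr b \<le> t powr E / t" .
    moreover have "t powr a \<le> t powr E" using E t by (intro powr_mono) auto
    ultimately show ?thesis by (simp add: algebra_simps)
  next
    case False
    \<comment> \<open>For a gap below 1, factor out the power at the midpoint \<open>s\<close>. The
      remaining factor \<open>x + 1 / x\<close> is increasing for \<open>x \<ge> 1\<close>, so it is
      largest at gap 1, that is at \<open>x = y\<close>.\<close>
    define s where "s = (a + b) / 2"
    define x where "x = t powr ((a - b) / 2)"
    define y where "y = t powr (1 / 2)"
    have xy: "1 \<le> x" "x \<le> y"
      using t le False unfolding x_def y_def by (auto intro: ge_one_powr_ge_zero powr_mono)
    have y2: "y * y = t" using t by (simp add: y_def flip: powr_add)
    have "x + 1 / x \<le> y + 1 / y"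
    proof -
      have "1 * 1 \<le> x * y" using xy by (intro mult_mono) auto
      then have "0 \<le> (y - x) * (x * y - 1) / (x * y)" using xy by simp
      also have "\<dots> = (y + 1 / y) - (x + 1 / x)" using xy by (simp add: field_simps)
      finally show ?thesis by simp
    qed
    then have "t powr s * (x + 1 / x) \<le> t powr s * (y + 1 / y)"
      by (rule mult_left_mono) simp
    moreover have "t powr s * (x + 1 / x) = t powr a + t powr b"
    proof -
      have "t powr a = t powr s * x" "t powr b = t powr s / x"
        by (simp_all add: s_def x_def field_simps flip: powr_add powr_diff)
      then show ?thesis by (simp add: algebra_simps)
    qed
    moreover have "t powr s * (y + 1 / y) = (1 + 1 / t) * t powr (s + 1 / 2)"
    proof -
      have "t powr (s + 1 / 2) = t powr s * y" by (simp add: y_def powr_add)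
      then show ?thesis using xy by (simp add: field_simps flip: y2)
    qed
    moreover have "(1 + 1 / t) * t powr (s + 1 / 2) \<le> (1 + 1 / t) * t powr E"
      using E t by (intro mult_left_mono powr_mono) (auto simp: s_def add_divide_distrib)
    ultimately show ?thesis by linarith
  qed
  show ?thesis
    using main[of a b] main[of b a] E by (cases "b \<le> a") (simp_all add: add.commute)
qed

text \<open>Going to the slice of \<open>X\<close> with first bit \<open>b\<close> costs one flip if
  the first bit of the query differs.\<close>

lemma set_dist_Cons_le:
  assumes "finite X" "{y. b # y \<in> X} \<noteq> {}"
  shows "set_dist X (c # x) \<le> of_bool (b \<noteq> c) + set_dist {y. b # y \<in> X} x"
proof -
  have "finite {y. b # y \<in> X}"
    using finite_vimageI[OF assms(1), of "(#) b"] by (simp add: vimage_def)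
  then obtain y where "b # y \<in> X" "set_dist {y. b # y \<in> X} x = hamming_dist y x"
    using set_dist_attained[of "{y. b # y \<in> X}" x] assms(2) by auto
  then show ?thesis
    using set_dist_le[OF assms(1), of "b # y" "c # x"] by simp
qed

text \<open>Splitting off the first bit: \<open>powr_add_powr_le\<close> is the two-point inequality that makes the
  induction close.\<close>

lemma card_le_powr_avg_set_dist:
  fixes t :: real
  assumes "X \<subseteq> {x. length x = m}" "X \<noteq> {}" and t: "1 \<le> t"
  shows "card X \<le> (1 + 1 / t) ^ m * t powr (m / 2 - cube_avg m (set_dist X))"
  using assms(1,2)
proof (induction m arbitrary: X)
  case 0
  then have "X = {[]}" by auto
  then show ?case using t by (simp add: set_dist_def)
next
  case (Suc m)
  define Y where "Y b = {y. b # y \<in> X}" for b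
  \<comment> \<open>\<open>e b\<close> and \<open>E\<close> are the exponents of \<open>t\<close> in
    the bounds for the slice \<open>Y b\<close> and for \<open>X\<close>; the three conditions of
    \<open>powr_add_powr_le\<close> are checked for them.\<close>
  define e where "e b = m / 2 - cube_avg m (set_dist (Y b))" for b
  define E where "E = Suc m / 2 - cube_avg (Suc m) (set_dist X)"
  have fin: "finite X" by (rule finite_subset_cube[OF Suc.prems(1)])
  have finY: "finite (Y b)" for b
    using finite_vimageI[OF fin, of "(#) b"] by (simp add: vimage_def Y_def)
  have "[] \<notin> X" using Suc.prems(1) by auto
  then have "X = (#) True ` Y True \<union> (#) False ` Y False"
    unfolding Y_def by (auto simp: image_iff) (metis (full_types) list.exhaust)
  then have "card X = card ((#) True ` Y True) + card ((#) False ` Y False)"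
    using finY by (metis (no_types, lifting) card_Un_disjoint disjoint_iff finite_imageI imageE list.inject)
  then have card: "card X = card (Y True) + card (Y False)"
    by (simp add: card_image)
  have IH: "card (Y b) \<le> (1 + 1 / t) ^ m * t powr e b" if "Y b \<noteq> {}" for b
    unfolding e_def using Suc.prems(1) that by (intro Suc.IH) (auto simp: Y_def)
  have avg: "cube_avg m (\<lambda>x. set_dist X (c # x)) \<le> of_bool (b \<noteq> c) + cube_avg m (set_dist (Y b))"
    if "Y b \<noteq> {}" for b c
  proof -
    have "real (set_dist X (c # x)) \<le> of_bool (b \<noteq> c) + set_dist (Y b) x" for x
      using set_dist_Cons_le[OF fin, of b c x] that by (auto simp: Y_def of_bool_def split: if_splits)
    then have "cube_avg m (\<lambda>x. set_dist X (c # x)) \<le> cube_avg m (\<lambda>x. of_bool (b \<noteq> c) + set_dist (Y b) x)"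
      by (rule cube_avg_mono)
    then show ?thesis by (simp add: cube_avg_add)
  qed
  \<comment> \<open>Measuring both halves of the cube against one slice raises the mean distance by
    at most 1/2, exactly the growth of \<open>m / 2\<close>.\<close>
  have E1: "e b \<le> E" if "Y b \<noteq> {}" for b
    using avg[OF that, of True] avg[OF that, of False]
    by (cases b) (simp_all add: e_def E_def cube_avg_Suc field_simps)
  \<comment> \<open>Measuring each half against its own slice costs no flip, so the growth of
    \<open>m / 2\<close> is gained in full.\<close>
  have E2: "(e True + e False + 1) / 2 \<le> E" if "Y True \<noteq> {}" "Y False \<noteq> {}"
    using avg[OF that(1), of True] avg[OF that(2), of False]
    by (simp add: e_def E_def cube_avg_Suc field_simps)
  have single: "(1 + 1 / t) ^ m * t powr e b \<le> (1 + 1 / t) ^ Suc m * t powr E" if "Y b \<noteq> {}" for b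
    using t E1[OF that] by (intro mult_mono powr_mono power_increasing) auto
  have "real (card X) \<le> (1 + 1 / t) ^ Suc m * t powr E"
  proof (cases "Y True = {} \<or> Y False = {}")
    case True
    have "Y True \<noteq> {} \<or> Y False \<noteq> {}"
      using card Suc.prems(2) fin by auto
    then obtain b where "Y b \<noteq> {}" "card X = card (Y b)"
      using True card by (metis add.right_neutral add_0 card.empty)
    then show ?thesis using IH[of b] single[of b] by linarith
  next
    case False
    then have "real (card X) \<le> (1 + 1 / t) ^ m * (t powr e True + t powr e False)"
      using IH[of True] IH[of False] card by (simp add: algebra_simps)
    also have "\<dots> \<le> (1 + 1 / t) ^ m * ((1 + 1 / t) * t powr E)"
      using t False E1 E2 by (intro mult_left_mono powr_add_powr_le) auto
    finally show ?thesis by (simp add: mult_ac)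
  qed
  then show ?case by (simp add: E_def)
qed

text \<open>The bound \<open>(1 + 1 / t) * t powr r\<close> per dimension is minimal where
  \<open>t + 1 = 1 / r\<close>; the condition \<open>t \<ge> 1\<close> then amounts to
  \<open>r \<le> 1 / 2\<close>.\<close>

lemma card_le_entropy:
  assumes X: "X \<subseteq> {x. length x = m}" "X \<noteq> {}" and m: "m \<ge> 1"
  shows "log 2 (card X) / m \<le> bin_entropy (1 / 2 - cube_avg m (set_dist X) / m)"
proof -
  define r where "r = 1 / 2 - cube_avg m (set_dist X) / m"
  have card: "card X > 0" using X finite_subset_cube by (auto simp: card_gt_0_iff)
  have rm: "m / 2 - cube_avg m (set_dist X) = r * m"
    using m by (simp add: r_def field_simps)
  have r: "0 \<le> r" "r \<le> 1 / 2"
    using avg_set_dist_le_half[OF X] cube_avg_mono[of m "\<lambda>x. 0" "set_dist X"] m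
    by (auto simp: r_def field_simps)
  have le: "card X \<le> (1 + 1 / t) ^ m * t powr (r * m)" if "1 \<le> t" for t
    using card_le_powr_avg_set_dist[OF X that] rm by simp
  show ?thesis
  proof (cases "r = 0")
    case True
    \<comment> \<open>For \<open>r = 0\<close> there is no finite minimizer. The power of
      \<open>t\<close> is 1, and letting \<open>t\<close> tend to infinity leaves at most one point
      in \<open>X\<close>.\<close>
    have "(\<lambda>k. (1 + 1 / real k) ^ m) \<longlonglongrightarrow> (1 + 0) ^ m"
      by (intro tendsto_intros lim_1_over_n)
    moreover have "real (card X) \<le> (1 + 1 / real k) ^ m" if "k \<ge> 1" for k
      using le[of "real k"] True that by simp
    ultimately have "real (card X) \<le> (1 + 0) ^ m"
      by (intro LIMSEQ_le_const) blast+
    then have "card X = 1" using card by simp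
    then show ?thesis using True by (simp add: r_def bin_entropy_def)
  next
    case False
    then have r0: "0 < r" "r < 1" using r by auto
    define t where "t = (1 - r) / r"
    have t: "1 \<le> t" using r0 r by (simp add: t_def field_simps)
    have "1 + 1 / t = 1 / (1 - r)" using r0 by (simp add: t_def field_simps)
    then have "ln (real (card X)) \<le> ln ((1 / (1 - r)) ^ m * t powr (r * m))"
      using le[OF t] card by simp
    also have "\<dots> = m * (r * (ln (1 - r) - ln r) - ln (1 - r))"
      using r0 t by (simp add: ln_mult ln_powr ln_realpow ln_div) (simp add: t_def ln_div r0 algebra_simps)
    finally have "ln (real (card X)) / m \<le> r * (ln (1 - r) - ln r) - ln (1 - r)"
      using m by (simp add: pos_divide_le_eq mult.commute)
    then have "ln (real (card X)) / m / ln 2 \<le> (r * (ln (1 - r) - ln r) - ln (1 - r)) / ln 2"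
      by (rule divide_right_mono) simp
    moreover have "bin_entropy r = (r * (ln (1 - r) - ln r) - ln (1 - r)) / ln 2"
      using False r0 by (simp add: bin_entropy_def log_def ln_div field_simps)
    ultimately show ?thesis by (simp add: r_def log_def mult.commute)
  qed
qed

section \<open>Chebyshev's inequality for independent samples\<close>

lemma finite_set_replicate_pmf:
  "finite (set_pmf p) \<Longrightarrow> finite (set_pmf (replicate_pmf k p))"
  using finite_lists_length_eq[of "set_pmf p" k] by (simp add: set_replicate_pmf lists_eq_set)

lemma expectation_replicate_pmf_Suc:
  fixes h :: "'a list \<Rightarrow> real"
  assumes "finite (set_pmf p)"
  shows "measure_pmf.expectation (replicate_pmf (Suc k) p) h =
    measure_pmf.expectation p (\<lambda>x. measure_pmf.expectation (replicate_pmf k p) (\<lambda>xs. h (x # xs)))"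
proof -
  have "replicate_pmf (Suc k) p = p \<bind> (\<lambda>x. map_pmf ((#) x) (replicate_pmf k p))"
    by (simp add: map_pmf_def)
  then show ?thesis
    using assms finite_set_replicate_pmf[OF assms]
    by (subst integral_measure_pmf[of "set_pmf p"])
      (auto simp del: replicate_pmf.simps simp: pmf_expectation_bind[of "set_pmf p"])
qed

text \<open>Splitting off one sample, the cross term in the square vanishes by independence and zero
  mean. The two claims share one induction because the second uses the first for
  \<open>k\<close>.\<close>

lemma replicate_pmf_sum_moments:
  fixes g :: "'a \<Rightarrow> real"
  assumes fin: "finite (set_pmf p)" and g: "measure_pmf.expectation p g = 0"
  shows "measure_pmf.expectation (replicate_pmf k p) (\<lambda>xs. \<Sum>x\<leftarrow>xs. g x) = 0"
    and "measure_pmf.expectation (replicate_pmf k p) (\<lambda>xs. (\<Sum>x\<leftarrow>xs. g x)\<^sup>2) =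
      k * measure_pmf.expectation p (\<lambda>x. (g x)\<^sup>2)"
proof (induction k)
  case (Suc k)
  note int = integrable_measure_pmf_finite[OF fin]
    integrable_measure_pmf_finite[OF finite_set_replicate_pmf[OF fin]]
  {
    case 1
    show ?case
      using g Suc.IH(1) by (simp add: expectation_replicate_pmf_Suc fin int del: replicate_pmf.simps)
  next
    case 2
    show ?case
      using g Suc.IH by (simp add: expectation_replicate_pmf_Suc fin int power2_sum algebra_simps
          del: replicate_pmf.simps)
  }
qed simp_all

lemma Chebyshev_replicate_pmf:
  fixes g :: "'a \<Rightarrow> real"
  assumes fin: "finite (set_pmf p)" and k: "k > 0" and \<delta>: "\<delta> > 0"
  defines "\<mu> \<equiv> measure_pmf.expectation p g"
  shows "measure_pmf.prob (replicate_pmf k p) {xs. \<delta> \<le> \<bar>(\<Sum>x\<leftarrow>xs. g x) - k * \<mu>\<bar>} \<le>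
    k * (measure_pmf.expectation p (\<lambda>x. (g x)\<^sup>2) - \<mu>\<^sup>2) / \<delta>\<^sup>2"
proof -
  let ?R = "replicate_pmf k p"
  let ?h = "\<lambda>xs. (\<Sum>x\<leftarrow>xs. g x - \<mu>)\<^sup>2"
  note int = integrable_measure_pmf_finite[OF fin]
  have zero: "measure_pmf.expectation p (\<lambda>x. g x - \<mu>) = 0"
    by (simp add: int \<mu>_def)
  have var: "measure_pmf.expectation p (\<lambda>x. (g x - \<mu>)\<^sup>2) =
      measure_pmf.expectation p (\<lambda>x. (g x)\<^sup>2) - \<mu>\<^sup>2"
    by (simp add: power2_diff int) (simp add: \<mu>_def power2_eq_square)
  \<comment> \<open>Centring each summand absorbs \<open>k * \<mu>\<close> only for lists of length
    \<open>k\<close>, hence the restriction to the support.\<close>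
  have "(\<Sum>x\<leftarrow>xs. g x) - k * \<mu> = (\<Sum>x\<leftarrow>xs. g x - \<mu>)" if "xs \<in> set_pmf ?R" for xs
    using that by (simp add: set_replicate_pmf sum_list_subtractf sum_list_triv)
  then have "measure_pmf.prob ?R {xs. \<delta> \<le> \<bar>(\<Sum>x\<leftarrow>xs. g x) - k * \<mu>\<bar>} \<le>
      measure_pmf.prob ?R {xs. \<delta>\<^sup>2 \<le> ?h xs}"
    using \<delta> by (intro measure_pmf.finite_measure_mono_AE)
      (auto simp: AE_measure_pmf_iff simp flip: abs_le_square_iff)
  also have "\<dots> \<le> measure_pmf.expectation ?R ?h / \<delta>\<^sup>2"
    using \<delta> integral_Markov_inequality_measure[where A = UNIV and u = ?h and c = "\<delta>\<^sup>2",
        OF integrable_measure_pmf_finite[OF finite_set_replicate_pmf[OF fin]]]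
    by simp
  finally show ?thesis
    using replicate_pmf_sum_moments(2)[OF fin zero, of k] by (simp add: var)
qed

section \<open>Permanents, codewords and assignment problems\<close>

lemma permanent_transpose:
  fixes A :: "'a :: comm_semiring_1 mat"
  assumes "A \<in> carrier_mat n n"
  shows "permanent (transpose_mat A) = permanent A"
proof -
  let ?S = "{\<sigma>. \<sigma> permutes {0..<n}}"
  \<comment> \<open>Reordering the factors by the inverse of \<open>\<sigma>\<close> moves it to the
    column index; inversion then permutes the terms of the outer sum.\<close>
  have "(\<Prod>i = 0..<n. A $$ (\<sigma> i, i)) = (\<Prod>i = 0..<n. A $$ (i, inv_into UNIV \<sigma> i))"
    if "\<sigma> permutes {0..<n}" for \<sigma>
    by (subst prod.permute[OF permutes_inv[OF that]]) (simp add: permutes_inverses[OF that])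
  then have "(\<Sum>\<sigma>\<in>?S. \<Prod>i = 0..<n. A $$ (\<sigma> i, i)) = (\<Sum>\<sigma>\<in>?S. \<Prod>i = 0..<n. A $$ (i, inv_into UNIV \<sigma> i))"
    by (intro sum.cong) auto
  also have "\<dots> = (\<Sum>\<sigma>\<in>?S. \<Prod>i = 0..<n. A $$ (i, \<sigma> i))"
    by (rule sum_permutations_inverse[symmetric])
  finally have "(\<Sum>\<sigma>\<in>?S. \<Prod>i = 0..<n. A $$ (\<sigma> i, i)) = (\<Sum>\<sigma>\<in>?S. \<Prod>i = 0..<n. A $$ (i, \<sigma> i))" .
  moreover have "transpose_mat A $$ (i, \<sigma> i) = A $$ (\<sigma> i, i)" if "\<sigma> permutes {0..<n}" "i < n" for \<sigma> i
    using assms that permutes_in_image[OF that(1), of i] by auto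
  ultimately show ?thesis
    using assms by (simp add: permanent_def)
qed

definition one_permutations :: "real mat \<Rightarrow> (nat \<Rightarrow> nat) set" where
  "one_permutations B = {\<sigma>. \<sigma> permutes {0..<dim_row B} \<and> (\<forall>i<dim_row B. B $$ (i, \<sigma> i) = 1)}"

text \<open>Each product is 1 if the permutation meets only ones, and otherwise has a factor
  0.\<close>

lemma permanent_eq_card:
  assumes B: "B \<in> carrier_mat n n" "elements_mat B \<subseteq> {0, 1}"
  shows "permanent B = card (one_permutations B)"
proof -
  have "(\<Prod>i = 0..<n. B $$ (i, \<sigma> i)) = of_bool (\<forall>i<n. B $$ (i, \<sigma> i) = 1)"
    if \<sigma>: "\<sigma> permutes {0..<n}" for \<sigma>
  proof (cases "\<forall>i<n. B $$ (i, \<sigma> i) = 1")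
    case False
    then obtain i where i: "i < n" "B $$ (i, \<sigma> i) \<noteq> 1" by blast
    then have "B $$ (i, \<sigma> i) \<in> elements_mat B"
      using B \<sigma> permutes_in_image[OF \<sigma>, of i] by (intro elements_matI[of B n n]) auto
    then have "B $$ (i, \<sigma> i) = 0" using B i by auto
    then show ?thesis using i False by auto
  qed simp
  then have "permanent B = (\<Sum>\<sigma> | \<sigma> permutes {0..<n}. of_bool (\<forall>i<n. B $$ (i, \<sigma> i) = 1))"
    using B by (simp add: permanent_def)
  also have "\<dots> = card ({\<sigma>. \<sigma> permutes {0..<n}} \<inter> {\<sigma>. \<forall>i<n. B $$ (i, \<sigma> i) = 1})"
    by (simp add: finite_permutations)
  also have "{\<sigma>. \<sigma> permutes {0..<n}} \<inter> {\<sigma>. \<forall>i<n. B $$ (i, \<sigma> i) = 1} = one_permutations B"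
    using B by (auto simp: one_permutations_def)
  finally show ?thesis .
qed

text \<open>The vertex of the cube that represents \<open>\<sigma>\<close>, with rows in the order
  in which \<open>block\<close> cuts a string.\<close>

definition codeword :: "real mat \<Rightarrow> (nat \<Rightarrow> nat \<Rightarrow> bool list) \<Rightarrow> (nat \<Rightarrow> nat) \<Rightarrow> bool list" where
  "codeword B \<phi> \<sigma> = concat (map (\<lambda>i. \<phi> i (\<sigma> i)) [0..<dim_row B])"

lemma one_permutations_less:
  assumes "B \<in> carrier_mat n n" "\<sigma> \<in> one_permutations B" "i < n"
  shows "\<sigma> i < n" "B $$ (i, \<sigma> i) = 1"
  using assms permutes_in_image[of \<sigma> "{0..<n}" i] by (auto simp: one_permutations_def)

lemma length_row_code:
  assumes "B \<in> carrier_mat n n" "row_codes B \<phi>" "\<sigma> \<in> one_permutations B" "i < n"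
  shows "length (\<phi> i (\<sigma> i)) = row_bits B i"
  using assms one_permutations_less[OF assms(1,3,4)] by (fastforce simp: row_codes_def)

lemma length_codeword:
  assumes "B \<in> carrier_mat n n" "row_codes B \<phi>" "\<sigma> \<in> one_permutations B"
  shows "length (codeword B \<phi> \<sigma>) = m_plus B"
proof -
  have "length (codeword B \<phi> \<sigma>) = (\<Sum>i = 0..<n. length (\<phi> i (\<sigma> i)))"
    using assms(1) by (simp add: codeword_def length_concat comp_def interv_sum_list_conv_sum_set_nat)
  also have "\<dots> = (\<Sum>i = 0..<n. row_bits B i)"
    using length_row_code[OF assms] by (intro sum.cong) auto
  finally show ?thesis using assms(1) by (simp add: m_plus_def)
qed

text \<open>The length of each block depends on the row only, so the concatenation can be decoded;
  injectivity of \<open>\<phi> i\<close> on the ones of row \<open>i\<close> then recovers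
  \<open>\<sigma> i\<close>.\<close>

lemma inj_on_codeword:
  assumes B: "B \<in> carrier_mat n n" and \<phi>: "row_codes B \<phi>"
  shows "inj_on (codeword B \<phi>) (one_permutations B)"
proof (rule inj_onI)
  fix \<sigma> \<tau>
  assume st: "\<sigma> \<in> one_permutations B" "\<tau> \<in> one_permutations B" and eq: "codeword B \<phi> \<sigma> = codeword B \<phi> \<tau>"
  have "map (\<lambda>i. \<phi> i (\<sigma> i)) [0..<n] = map (\<lambda>i. \<phi> i (\<tau> i)) [0..<n]"
  proof (rule concat_injective)
    show "\<forall>(y, z) \<in> set (zip (map (\<lambda>i. \<phi> i (\<sigma> i)) [0..<n]) (map (\<lambda>i. \<phi> i (\<tau> i)) [0..<n])).
        length y = length z"
      using length_row_code[OF B \<phi> st(1)] length_row_code[OF B \<phi> st(2)]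
      by (auto simp: set_zip)
  qed (use eq B in \<open>simp_all add: codeword_def\<close>)
  then have code: "\<phi> i (\<sigma> i) = \<phi> i (\<tau> i)" if "i < n" for i using that by simp
  show "\<sigma> = \<tau>"
  proof
    fix i
    show "\<sigma> i = \<tau> i"
    proof (cases "i < n")
      case True
      then have "inj_on (\<phi> i) {j. j < n \<and> B $$ (i, j) = 1}"
        using B \<phi> by (auto simp: row_codes_def)
      then show ?thesis
        using code[OF True] one_permutations_less[OF B st(1) True] one_permutations_less[OF B st(2) True]
        by (auto dest: inj_onD)
    next
      case False
      then show ?thesis using st B by (simp add: one_permutations_def permutes_def)
    qed
  qed
qed

text \<open>Each block starts where the previous one ends, so the first \<open>k\<close> blocks form
  a prefix of \<open>x\<close>.\<close>

lemma concat_blocks: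
  assumes "length x = m_plus B"
  shows "concat (map (block B x) [0..<dim_row B]) = x"
proof -
  have "concat (map (block B x) [0..<k]) = take (\<Sum>l = 0..<k. row_bits B l) x" for k
    by (induction k) (simp_all add: block_def take_add)
  then show ?thesis using assms by (simp add: m_plus_def)
qed

lemma length_block:
  assumes "length x = m_plus B" "i < dim_row B"
  shows "length (block B x i) = row_bits B i"
proof -
  have "(\<Sum>l = 0..<Suc i. row_bits B l) \<le> m_plus B"
    unfolding m_plus_def using assms(2) by (intro sum_mono2) auto
  then show ?thesis using assms(1) by (simp add: block_def)
qed

text \<open>Feasible assignments are the permutations on ones, and the cost of one is the Hamming
  distance of its codeword from \<open>x\<close>, added up block by block.\<close>

lemma min_assignment_weighting:
  assumes B: "B \<in> carrier_mat n n" and \<phi>: "row_codes B \<phi>" and x: "length x = m_plus B"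
  shows "min_assignment (weighting B \<phi> x) = set_dist (codeword B \<phi> ` one_permutations B) x"
proof -
  let ?W = "weighting B \<phi> x"
  have "assignments ?W = one_permutations B"
    using B permutes_in_image
    by (fastforce simp: assignments_def one_permutations_def weighting_def split: if_splits)
  moreover have "(\<Sum>i = 0..<dim_row ?W. the (?W $$ (i, \<sigma> i))) = hamming_dist (codeword B \<phi> \<sigma>) x"
    if \<sigma>: "\<sigma> \<in> one_permutations B" for \<sigma>
  proof -
    have "(\<Sum>i = 0..<dim_row ?W. the (?W $$ (i, \<sigma> i))) =
        (\<Sum>i = 0..<n. hamming_dist (\<phi> i (\<sigma> i)) (block B x i))"
      using B one_permutations_less[OF B \<sigma>] by (intro sum.cong) (auto simp: weighting_def)
    also have "\<dots> = (\<Sum>i\<leftarrow>[0..<n]. hamming_dist (\<phi> i (\<sigma> i)) (block B x i))"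
      by (simp add: interv_sum_list_conv_sum_set_nat)
    also have "\<dots> = hamming_dist (codeword B \<phi> \<sigma>) (concat (map (block B x) [0..<n]))"
      using B length_row_code[OF B \<phi> \<sigma>] length_block[OF x]
      by (subst hamming_dist_concat[symmetric]) (simp_all add: codeword_def)
    finally show ?thesis using concat_blocks[OF x] B by simp
  qed
  ultimately show ?thesis
    by (simp add: min_assignment_def set_dist_def image_image)
qed

section \<open>Accuracy and cost of the randomized estimate\<close>

theorem theorem5p3:
  fixes A :: "real mat" and n :: nat and \<phi> :: "nat \<Rightarrow> nat \<Rightarrow> bool list"
  assumes "A \<in> carrier_mat n n"
    and "elements_mat A \<subseteq> {0, 1}"
    and "permanent A > 0"
    and "m_min A \<ge> 1"
    and "row_codes (oriented A) \<phi>"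
  shows "\<exists>\<rho>\<in>{0..1/2}.
      1 - bin_entropy (1/2 - \<rho>) \<le> log 2 (permanent A) / real (m_min A) \<and>
      log 2 (permanent A) / real (m_min A) \<le> bin_entropy \<rho> \<and>
      (\<forall>\<epsilon>>0.
        measure_pmf.prob (algorithm A \<phi> \<epsilon>) {(\<beta>, problems). \<bar>\<beta> - \<rho>\<bar> \<le> \<epsilon>} \<ge> 0.9 \<and>
        (\<forall>(\<beta>, problems) \<in> set_pmf (algorithm A \<phi> \<epsilon>).
          int (length problems) = \<lceil>48 / (real (m_min A) * \<epsilon>\<^sup>2)\<rceil> \<and>
          set problems \<subseteq> carrier_mat n n))"
proof -
  define B where "B = oriented A"
  define m where "m = m_min A"
  define X where "X = codeword B \<phi> ` one_permutations B"
  define D where "D = cube_avg m (set_dist X)"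
  \<comment> \<open>This is the expected value of the output, since each sample has mean distance
    \<open>D\<close>.\<close>
  define \<rho> where "\<rho> = 1 / 2 - D / m"
  have m: "m \<ge> 1" using assms(4) by (simp add: m_def)
  have B: "B \<in> carrier_mat n n" using assms(1) by (auto simp: B_def oriented_def)
  have \<phi>: "row_codes B \<phi>" using assms(5) by (simp add: B_def)
  have mB: "m_plus B = m" by (simp add: B_def m_def m_plus_oriented)
  have "elements_mat B \<subseteq> {0, 1}"
    using assms(1,2) by (auto simp: B_def oriented_def elements_mat_def)
  then have "permanent B = card (one_permutations B)" by (rule permanent_eq_card[OF B])
  then have per: "permanent A = card X"
    using permanent_transpose[OF assms(1)] inj_on_codeword[OF B \<phi>]
    by (simp add: X_def card_image) (simp add: B_def oriented_def split: if_splits)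
  have X: "X \<subseteq> {x. length x = m}"
    using length_codeword[OF B \<phi>] by (auto simp: X_def mB)
  have X0: "X \<noteq> {}" using per assms(3) by auto
  have "0 \<le> D" unfolding D_def using cube_avg_mono[of m "\<lambda>x. 0" "set_dist X"] by simp
  moreover have "D \<le> m / 2" unfolding D_def by (rule avg_set_dist_le_half[OF X X0])
  ultimately have \<rho>: "\<rho> \<in> {0..1/2}" using m by (simp add: \<rho>_def field_simps)
  have lower: "1 - bin_entropy (1 / 2 - \<rho>) \<le> log 2 (permanent A) / m"
    using card_ge_entropy[OF X X0 m] by (simp add: \<rho>_def D_def per)
  have upper: "log 2 (permanent A) / m \<le> bin_entropy \<rho>"
    using card_le_entropy[OF X X0 m] by (simp add: \<rho>_def D_def per)
  have dist: "min_assignment (weighting B \<phi> x) = set_dist X x" if "length x = m" for x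
    using min_assignment_weighting[OF B \<phi>, of x] that by (simp add: X_def mB)
  have var: "cube_avg m (\<lambda>x. (set_dist X x)\<^sup>2) - D\<^sup>2 \<le> m / 4"
    using cube_avg_variance_le[OF set_dist_Lipschitz[OF X X0]] by (simp add: D_def)
  have alg: "measure_pmf.prob (algorithm A \<phi> \<epsilon>) {(\<beta>, problems). \<bar>\<beta> - \<rho>\<bar> \<le> \<epsilon>} \<ge> 0.9"
    "\<forall>(\<beta>, problems) \<in> set_pmf (algorithm A \<phi> \<epsilon>).
      int (length problems) = \<lceil>48 / (m * \<epsilon>\<^sup>2)\<rceil> \<and> set problems \<subseteq> carrier_mat n n"
    if \<epsilon>: "\<epsilon> > 0" for \<epsilon> :: real
  proof -
    define U where "U = pmf_of_set {x :: bool list. length x = m}"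
    define k where "k = num_samples A \<epsilon>"
    define R where "R = replicate_pmf k U"
    have pos: "0 < 48 / (m * \<epsilon>\<^sup>2)" using m \<epsilon> by simp
    \<comment> \<open>A nonnegative ceiling survives the conversion to \<open>nat\<close> in
      \<open>num_samples\<close>.\<close>
    then have "0 \<le> \<lceil>48 / (m * \<epsilon>\<^sup>2)\<rceil>" by linarith
    then have k: "int k = \<lceil>48 / (m * \<epsilon>\<^sup>2)\<rceil>"
      by (simp only: k_def num_samples_def m_def int_nat_eq if_True)
    then have kge: "48 / (m * \<epsilon>\<^sup>2) \<le> k" by linarith
    with pos have k0: "k > 0" by (cases k) auto
    have setU: "set_pmf U = {x. length x = m}"
      unfolding U_def by (rule set_pmf_of_set[OF cube_nonempty finite_cube])
    have setR: "length xs = k \<and> (\<forall>x\<in>set xs. length x = m)" if "xs \<in> set_pmf R" for xs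
      using that by (auto simp: R_def set_replicate_pmf setU)
    have algR: "algorithm A \<phi> \<epsilon> = map_pmf (estimate A \<phi>) R"
      by (simp add: algorithm_def R_def k_def U_def m_def)
    have est: "estimate A \<phi> xs =
        (1 / 2 - (\<Sum>x\<leftarrow>xs. real (set_dist X x)) / k / m, map (weighting B \<phi>) xs)"
      if "xs \<in> set_pmf R" for xs
    proof -
      have "(\<Sum>x\<leftarrow>xs. real (min_assignment (weighting B \<phi> x))) = (\<Sum>x\<leftarrow>xs. real (set_dist X x))"
        using setR[OF that] dist by (intro arg_cong[where f = sum_list] map_cong) simp_all
      moreover have "concat (map (\<lambda>x. [weighting B \<phi> x]) xs) = map (weighting B \<phi>) xs"
        by (induction xs) auto
      ultimately show ?thesis
        using setR[OF that] by (simp add: estimate_def solve_def comp_def flip: B_def m_def)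
    qed
    show "\<forall>(\<beta>, problems) \<in> set_pmf (algorithm A \<phi> \<epsilon>).
        int (length problems) = \<lceil>48 / (m * \<epsilon>\<^sup>2)\<rceil> \<and> set problems \<subseteq> carrier_mat n n"
      using B setR k by (auto simp: algR est weighting_def)
    \<comment> \<open>The deviation event with the denominator \<open>k * m\<close> cleared. It
      includes the boundary, which is harmless as only an upper bound on its probability is
      needed.\<close>
    let ?bad = "{xs. k * m * \<epsilon> \<le> \<bar>(\<Sum>x\<leftarrow>xs. real (set_dist X x)) - k * D\<bar>}"
    have mean: "measure_pmf.expectation U (\<lambda>x. real (set_dist X x)) = D"
      by (simp add: U_def D_def expectation_cube)
    have "measure_pmf.prob R ?bad \<le>
        k * (measure_pmf.expectation U (\<lambda>x. (real (set_dist X x))\<^sup>2) - D\<^sup>2) / (k * m * \<epsilon>)\<^sup>2"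
      unfolding R_def using Chebyshev_replicate_pmf[of U k "k * m * \<epsilon>" "set_dist X"] k0 m \<epsilon>
      by (simp add: mean setU finite_cube)
    also have "\<dots> \<le> k * (m / 4) / (k * m * \<epsilon>)\<^sup>2"
      using var by (intro divide_right_mono mult_left_mono) (auto simp: U_def expectation_cube)
    also have "\<dots> = 1 / (4 * (k * (m * \<epsilon>\<^sup>2)))"
      using k0 m \<epsilon> by (simp add: field_simps power2_eq_square)
    \<comment> \<open>The number of samples is chosen so that
      \<open>k * m * \<epsilon>\<^sup>2 \<ge> 48\<close>.\<close>
    also have "\<dots> \<le> 1 / (4 * 48)"
    proof (rule divide_left_mono)
      have "48 \<le> k * (m * \<epsilon>\<^sup>2)" using kge m \<epsilon> by (simp add: field_simps)
      then show "4 * 48 \<le> 4 * (k * (m * \<epsilon>\<^sup>2))" by simp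
    qed (use k0 m \<epsilon> in auto)
    finally have bad: "measure_pmf.prob R ?bad \<le> 0.1" by simp
    have good: "\<bar>fst (estimate A \<phi> xs) - \<rho>\<bar> \<le> \<epsilon>" if "xs \<in> set_pmf R" "xs \<notin> ?bad" for xs
    proof -
      let ?s = "\<Sum>x\<leftarrow>xs. real (set_dist X x)"
      have "fst (estimate A \<phi> xs) - \<rho> = - ((?s - k * D) / (k * m))"
        using est[OF that(1)] k0 m by (simp add: \<rho>_def field_simps)
      then have "\<bar>fst (estimate A \<phi> xs) - \<rho>\<bar> = \<bar>?s - k * D\<bar> / (k * m)" by simp
      also have "\<dots> \<le> \<epsilon>" using that(2) k0 m by (simp add: pos_divide_le_eq mult_ac)
      finally show ?thesis .
    qed
    have "0.9 \<le> 1 - measure_pmf.prob R ?bad" using bad by simp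
    also have "\<dots> = measure_pmf.prob R (- ?bad)"
      using measure_pmf.prob_compl[of ?bad R] by (simp add: Compl_eq_Diff_UNIV)
    also have "\<dots> \<le> measure_pmf.prob R (estimate A \<phi> -` {(\<beta>, problems). \<bar>\<beta> - \<rho>\<bar> \<le> \<epsilon>})"
      using good by (intro measure_pmf.finite_measure_mono_AE)
        (auto simp: AE_measure_pmf_iff case_prod_unfold)
    finally show "measure_pmf.prob (algorithm A \<phi> \<epsilon>) {(\<beta>, problems). \<bar>\<beta> - \<rho>\<bar> \<le> \<epsilon>} \<ge> 0.9"
      by (simp add: algR)
  qed
  show ?thesis
    using \<rho> lower upper alg unfolding m_def by blast
qed

end
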